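(* Let $\mathbb{F}$ be a field and $n\geq 1$. A bilinear form $\theta:\mu_0^n\times\mu_0^n\to\mathbb{F}$ is a Novikov cocycle of $\mu_0^n$ if and only if $\theta\in\mathsf{Z}^2_{\mathrm{BC}}(\mu_0^n,\mathbb{F})$.
   Context: $\mu_0^n$ is the $n$-dimensional (associative, commutative) null-filiform algebra over $\mathbb{F}$ with basis $e_1,\dots,e_n$ and product $e_ie_j=e_{i+j}$, where $e_m=0$ for $m>n$. An algebra is Novikov if $(xy)z=(xz)y$ and $(xy)z-x(yz)=(yx)z-y(xz)$ for all $x,y,z$. A bilinear form $\theta$ on $\mu_0^n$ is a Novikov cocycle if $\theta(xy,z)=\theta(xz,y)$ and $\theta(xy,z)-\theta(x,yz)=\theta(yx,z)-\theta(y,xz)$ for all $x,y,z\in\mu_0^n$. The space $\mathsf{Z}^2_{\mathrm{BC}}(\mu_0^n,\mathbb{F})$ of bicommutative cocycles consists of the bilinear forms $\theta$ on $\mu_0^n$ with $\theta(x,yz)=\theta(y,xz)$ and $\theta(xy,z)=\theta(xz,y)$ for all $x,y,z\in\mu_0^n$. *)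

theory Defs
  imports "Jordan_Normal_Form.Matrix"
begin

(* Elements of \<mu>_0^n are their coordinate vectors in carrier_vec n. Coordinates of
   vectors are numbered from 0, so the basis vector e_m (1 \<le> m \<le> n) is unit_vec n (m - 1),
   and the coefficient of e_m in x is x $ (m - 1). By convention e_m = 0 for m > n;
   the value for m = 0 is never used. *)
definition nf_basis :: "nat \<Rightarrow> nat \<Rightarrow> 'a::field vec" where
  "nf_basis n m = (if 1 \<le> m \<and> m \<le> n then unit_vec n (m - 1) else 0\<^sub>v n)"

(* The bilinear extension of e_i e_j = e_(i+j), written coordinatewise. *)
definition nf_mult :: "nat \<Rightarrow> 'a::field vec \<Rightarrow> 'a vec \<Rightarrow> 'a vec" where
  "nf_mult n x y =
     vec n (\<lambda>k. \<Sum>i<n. \<Sum>j<n. x $ i * y $ j * nf_basis n (Suc i + Suc j) $ k)"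

lemma nf_mult_basis:
  assumes "1 \<le> i" "i \<le> n" "1 \<le> j" "j \<le> n"
  shows "nf_mult n (nf_basis n i) (nf_basis n j) = (nf_basis n (i + j) :: 'a::field vec)"
proof (rule eq_vecI)
  fix k assume "k < dim_vec (nf_basis n (i + j) :: 'a vec)"
  then have k: "k < n"
    by (simp add: nf_basis_def split: if_splits)
  obtain a b where ab: "i = Suc a" "j = Suc b" "a < n" "b < n"
    using assms by (cases i; cases j) auto
  have e: "nf_basis n (Suc c) $ p = (if p = c then 1 else (0::'a))"
    if "c < n" "p < n" for c p
    using that by (auto simp: nf_basis_def)
  have "nf_mult n (nf_basis n i) (nf_basis n j) $ k =
      (\<Sum>p<n. \<Sum>q<n. (if p = a then 1 else 0) * (if q = b then 1 else 0)
         * (nf_basis n (Suc p + Suc q) :: 'a vec) $ k)"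
    using k ab by (simp add: nf_mult_def e)
  also have "\<dots> = nf_basis n (i + j) $ k"
    using ab by (subst sum.swap) (simp add: if_distrib[of "\<lambda>c. c * _"] cong: if_cong)
  finally show "nf_mult n (nf_basis n i) (nf_basis n j) $ k = (nf_basis n (i + j) :: 'a vec) $ k" .
qed (simp add: nf_mult_def nf_basis_def)

(* A form is a total function on vectors; only its values on carrier_vec n matter. *)
definition bilinear_form :: "nat \<Rightarrow> ('a::field vec \<Rightarrow> 'a vec \<Rightarrow> 'a) \<Rightarrow> bool" where
  "bilinear_form n \<theta> \<longleftrightarrow>
     (\<forall>x\<in>carrier_vec n. \<forall>y\<in>carrier_vec n. \<forall>z\<in>carrier_vec n.
        \<theta> (x + y) z = \<theta> x z + \<theta> y z \<and> \<theta> x (y + z) = \<theta> x y + \<theta> x z) \<and>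
     (\<forall>c. \<forall>x\<in>carrier_vec n. \<forall>y\<in>carrier_vec n.
        \<theta> (c \<cdot>\<^sub>v x) y = c * \<theta> x y \<and> \<theta> x (c \<cdot>\<^sub>v y) = c * \<theta> x y)"

definition novikov_cocycle :: "nat \<Rightarrow> ('a::field vec \<Rightarrow> 'a vec \<Rightarrow> 'a) \<Rightarrow> bool" where
  "novikov_cocycle n \<theta> \<longleftrightarrow> bilinear_form n \<theta> \<and>
     (\<forall>x\<in>carrier_vec n. \<forall>y\<in>carrier_vec n. \<forall>z\<in>carrier_vec n.
        \<theta> (nf_mult n x y) z = \<theta> (nf_mult n x z) y \<and>
        \<theta> (nf_mult n x y) z - \<theta> x (nf_mult n y z) =
          \<theta> (nf_mult n y x) z - \<theta> y (nf_mult n x z))"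

definition Z2_BC :: "nat \<Rightarrow> ('a::field vec \<Rightarrow> 'a vec \<Rightarrow> 'a) set" where
  "Z2_BC n = {\<theta>. bilinear_form n \<theta> \<and>
     (\<forall>x\<in>carrier_vec n. \<forall>y\<in>carrier_vec n. \<forall>z\<in>carrier_vec n.
        \<theta> x (nf_mult n y z) = \<theta> y (nf_mult n x z) \<and>
        \<theta> (nf_mult n x y) z = \<theta> (nf_mult n x z) y)}"

end

theory Submission
  imports Defs
begin

text \<open>
  Since the product of \<open>\<mu>\<^sub>0\<^sup>n\<close> is commutative, the terms \<open>\<theta>(xy, z)\<close> and \<open>\<theta>(yx, z)\<close> on the two
  sides of the left-symmetry identity
  \<open>\<theta>(xy, z) - \<theta>(x, yz) = \<theta>(yx, z) - \<theta>(y, xz)\<close> are equal and cancel. What remains is exactly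
  \<open>\<theta>(x, yz) = \<theta>(y, xz)\<close>, the left bicommutative identity; the right identity
  \<open>\<theta>(xy, z) = \<theta>(xz, y)\<close> is common to both notions.
\<close>

lemma nf_mult_commute: "nf_mult n x y = nf_mult n y x"
  unfolding nf_mult_def by (subst sum.swap) (simp add: ac_simps)

theorem mainTheorem5:
  fixes n :: nat and \<theta> :: "'a::field vec \<Rightarrow> 'a vec \<Rightarrow> 'a"
  assumes "n \<ge> 1"
    and "bilinear_form n \<theta>"
  shows "novikov_cocycle n \<theta> \<longleftrightarrow> \<theta> \<in> Z2_BC n"
proof -
  have cancel: "\<theta> (nf_mult n x y) z - \<theta> x (nf_mult n y z) =
        \<theta> (nf_mult n y x) z - \<theta> y (nf_mult n x z)
      \<longleftrightarrow> \<theta> x (nf_mult n y z) = \<theta> y (nf_mult n x z)" for x y z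
    by (simp add: nf_mult_commute[of n y x])
  show ?thesis
    unfolding novikov_cocycle_def Z2_BC_def cancel by blast
qed

end
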